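(* For all non-negative integers $i,j,N$ such that $i+j\le N$, the following identity holds between rational functions of $x$: $$\frac{d}{dx}\left(\frac{x^{\underline{N-i}}\,x^{\underline{N-j}}}{x^{\underline N}}\right)=\sum_{q=0}^{j}\ \sum_{p=i+j-q}^{\min\{N-q,\,N-1\}}\frac{(-1)^{N+p+q+1}\,(N-p)^{\underline q}\;i^{\underline q}\;j^{\underline q}\;(N-i-j)^{\underline{N-p-q}}\;x^{\underline{p-i}}\,x^{\underline{p-j}}\,(x-p+q)}{(N-p)\;q!\;x^{\underline{p+1}}\;(x-N+q)^{\underline q}} .$$
   Context: For an integer $r\ge0$, the falling factorial is $a^{\underline r}:=a(a-1)\cdots(a-r+1)$, with $a^{\underline 0}=1$. Empty sums are zero. Terms with $q>i$ are understood to be $0$ because of the factor $i^{\underline q}=0$; in all remaining terms every falling-factorial exponent is non-negative. *)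

theory Defs
  imports "HOL-Computational_Algebra.Computational_Algebra"
begin

definition ffact :: "'a::comm_ring_1 \<Rightarrow> nat \<Rightarrow> 'a" where
  "ffact a r = (\<Prod>k<r. a - of_nat k)"

lemma ffact_0 [simp]: "ffact a 0 = 1"
  by (simp add: ffact_def)

lemma ffact_Suc: "ffact a (Suc r) = ffact a r * (a - of_nat r)"
  by (simp add: ffact_def)

lemma ffact_of_nat_eq_0:
  assumes "m < r"
  shows "ffact (of_nat m :: 'a::comm_ring_1) r = 0"
  unfolding ffact_def using assms by (intro prod_zero) auto

text \<open>Rational functions in one variable over a field \<open>'a\<close> are the elements of
  \<^typ>\<open>'a poly fract\<close>; the variable is the following element.\<close>

definition ratfun_X :: "'a::field poly fract" where
  "ratfun_X = Fract [:0, 1:] 1"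

text \<open>The derivative of a rational function, given by the quotient rule. The description is proper:
  the result does not depend on the representing fraction (see \<open>ratfun_deriv_Fract\<close>).\<close>

definition ratfun_deriv :: "'a::field poly fract \<Rightarrow> 'a poly fract" where
  "ratfun_deriv f = (THE g. \<exists>a b. b \<noteq> 0 \<and> f = Fract a b \<and>
      g = Fract (pderiv a * b - a * pderiv b) (b ^ 2))"

lemma quotient_rule_well_defined:
  fixes a b c d :: "'a::field poly"
  assumes nz: "b \<noteq> 0" "d \<noteq> 0" and "Fract a b = Fract c d"
  shows "Fract (pderiv a * b - a * pderiv b) (b ^ 2) = Fract (pderiv c * d - c * pderiv d) (d ^ 2)"
proof -
  have eq: "a * d = c * b"
    using assms by (simp add: eq_fract)
  have deq: "a * pderiv d + d * pderiv a = c * pderiv b + b * pderiv c"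
    using arg_cong[OF eq, of pderiv] by (simp add: pderiv_mult)
  have "(pderiv a * b - a * pderiv b) * d\<^sup>2 - (pderiv c * d - c * pderiv d) * b\<^sup>2
      = b * d * ((a * pderiv d + d * pderiv a) - (c * pderiv b + b * pderiv c))
        - (a * d - c * b) * (d * pderiv b + b * pderiv d)"
    by (simp add: algebra_simps power2_eq_square)
  also have "\<dots> = 0"
    unfolding eq deq by simp
  finally show ?thesis
    using nz by (simp add: eq_fract)
qed

lemma ratfun_deriv_Fract:
  assumes "b \<noteq> 0"
  shows "ratfun_deriv (Fract a b) = Fract (pderiv a * b - a * pderiv b) (b ^ 2)"
  unfolding ratfun_deriv_def
proof (rule the_equality)
  show "\<exists>c d. d \<noteq> 0 \<and> Fract a b = Fract c d \<and>
      Fract (pderiv a * b - a * pderiv b) (b ^ 2) = Fract (pderiv c * d - c * pderiv d) (d ^ 2)"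
    using assms by blast
qed (use assms quotient_rule_well_defined in metis)

lemma ratfun_deriv_X: "ratfun_deriv ratfun_X = 1"
  by (simp add: ratfun_X_def ratfun_deriv_Fract One_fract_def pderiv_pCons eq_fract one_pCons power2_eq_square)

end

theory Submission
  imports Defs
begin

text \<open>
  With \<open>z = x - N\<close>, \<open>M = N - i - j\<close> and \<open>p = N - q - l\<close>, dividing both sides by
  the function being differentiated turns the left-hand side into \<open>H N - H i - H j\<close> with
  \<open>H n = \<Sum>k=1..n. 1 / (z + k)\<close>, and the right-hand side into a sum over \<open>0 \<le> q \<le> j\<close>, \<open>0 \<le> l \<le> M\<close>. For fixed \<open>l > 0\<close> the sum over \<open>q\<close> is a terminating very-well-poised
  \<open>5F4\<close> series at \<open>1\<close>, which is summable in closed form; the remaining sum over \<open>l\<close> gives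
  \<open>H N - H (i + j)\<close>. The part \<open>l = 0\<close> gives \<open>H (i + j) - H i - H j\<close>: by induction on \<open>i\<close>, its
  increments are again very-well-poised sums.
\<close>

section \<open>Preliminaries on fraction fields, rising and falling factorials\<close>

lemma of_nat_fract: "(of_nat n :: 'a::idom fract) = Fract (of_nat n) 1"
  by (induction n) (simp_all add: Zero_fract_def One_fract_def)

text \<open>Lets the summation lemmas, proved over any field of characteristic 0, be applied to the
  rational function \<open>x - of_nat N\<close> in place of \<open>z\<close>.\<close>

instance fract :: ("{idom, ring_char_0}") field_char_0
  by standard (auto intro!: injI simp: of_nat_fract eq_fract)

lemma pochhammer_shift_nonzero:
  fixes z :: "'a::field_char_0"
  assumes "\<And>n. z + of_nat n \<noteq> 0"
  shows "pochhammer (z + of_nat m) n \<noteq> 0"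
proof
  assume "pochhammer (z + of_nat m) n = 0"
  then obtain k where "z + of_nat m = - of_nat k"
    by (auto simp: pochhammer_eq_0_iff)
  then have "z + of_nat (m + k) = 0"
    by (simp add: add_eq_0_iff2 flip: add.assoc)
  with assms show False by blast
qed

lemma ffact_rec: "ffact (a + 1) (Suc r) = (a + 1) * ffact a r"
  unfolding ffact_def by (subst prod.lessThan_Suc_shift) (simp add: algebra_simps)

lemma ffact_eq_fact_binomial:
  "ffact (of_nat (l + q) :: 'a::field_char_0) q = fact q * of_nat ((l + q) choose q)"
proof -
  have "ffact (of_nat (l + q) :: 'a) q * fact l = fact (l + q)"
  proof (induction q)
    case (Suc q)
    have "ffact (of_nat (l + Suc q) :: 'a) (Suc q) = of_nat (l + Suc q) * ffact (of_nat (l + q)) q"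
      using ffact_rec[of "of_nat (l + q) :: 'a" q] by (simp add: add_ac)
    then have "ffact (of_nat (l + Suc q) :: 'a) (Suc q) * fact l = of_nat (l + Suc q) * fact (l + q)"
      by (simp only: Suc[symmetric] mult.assoc)
    then show ?case by simp
  qed simp
  then show ?thesis
    by (simp add: binomial_fact field_simps)
qed

section \<open>The terminating very-well-poised sum over q\<close>

text \<open>Up to a factor free of q, this is the q-th term of the very-well-poised 5F4 series at 1
  with leading parameter a = z + l + 1 and further parameters l + 1, -n, -m. The very-well-poised
  factor is a + 2q.\<close>

definition vwp_term :: "'a::field_char_0 \<Rightarrow> nat \<Rightarrow> nat \<Rightarrow> nat \<Rightarrow> nat \<Rightarrow> 'a" where
  "vwp_term z l n m q =
     of_nat ((l + q) choose q) * ffact (of_nat n) q * ffact (of_nat m) q * pochhammer (z + of_nat q + 1) l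
       * (z + of_nat l + 1 + 2 * of_nat q)
     / (pochhammer (z + of_nat n + 1) (l + q + 1) * pochhammer (z + of_nat m + 1) (l + q + 1))"

text \<open>WZ certificate for summing \<open>vwp_term\<close> over \<open>q\<close>, with the induction in \<open>m\<close>.\<close>

definition vwp_cert :: "'a::field_char_0 \<Rightarrow> nat \<Rightarrow> nat \<Rightarrow> nat \<Rightarrow> nat \<Rightarrow> 'a" where
  "vwp_cert z l n m q = of_nat q * of_nat ((l + q) choose q) * ffact (of_nat n) q * ffact (of_nat m) (q - 1)
       * pochhammer (z + of_nat q) (l + 1) * pochhammer (z + of_nat n + of_nat m + 2) l
     / (pochhammer (z + of_nat n + 1) (l + q) * pochhammer (z + of_nat m + 1) (l + q + 1))"

context
  fixes z :: "'a::field_char_0"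
  assumes z: "\<And>n. z + of_nat n \<noteq> 0"
begin

lemma pochhammer_shift_Suc_nonzero: "pochhammer (z + of_nat n + 1) k \<noteq> 0"
  using pochhammer_shift_nonzero[OF z, of "Suc n" k] by (simp add: add_ac)

text \<open>The multipliers are the reciprocals of the claimed sums for \<open>Suc m\<close> and
  \<open>m\<close>, so summing over q shows that sum times multiplier does not depend on m.
  Neighbouring terms differ only by linear factors, so the identity reduces to one between
  polynomials.\<close>

lemma vwp_cert_step:
  "vwp_term z l n (Suc m) q * pochhammer (z + of_nat n + of_nat (Suc m) + 1) (l + 1)
     - vwp_term z l n m q * pochhammer (z + of_nat n + of_nat m + 1) (l + 1)
   = vwp_cert z l n m q - vwp_cert z l n m (Suc q)"
proof -
  \<comment> \<open>\<open>a\<close> to \<open>v\<close> are factors shared by the terms;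
    \<open>s\<close>, \<open>t\<close>, \<open>r\<close> are the linear factors by which the
    Pochhammer symbols in the denominators differ.\<close>
  define a where "a = pochhammer (z + of_nat m + 2) (l + q)"
  define b where "b = pochhammer (z + of_nat n + 1) (l + q)"
  define W where "W = pochhammer (z + of_nat n + of_nat m + 2) l"
  define P where "P = pochhammer (z + of_nat q + 1) l"
  define c :: 'a where "c = of_nat ((l + q) choose q)"
  define u :: 'a where "u = ffact (of_nat n) q"
  define v :: 'a where "v = ffact (of_nat m) (q - 1)"
  let ?Q = "of_nat q :: 'a" and ?L = "of_nat l :: 'a" and ?n = "of_nat n :: 'a" and ?m = "of_nat m :: 'a"
  define s where "s = z + ?m + 1"
  define t where "t = z + ?m + ?L + ?Q + 2"
  define r where "r = z + ?n + ?L + ?Q + 1"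
  have nz: "a \<noteq> 0" "b \<noteq> 0" "s \<noteq> 0" "t \<noteq> 0" "r \<noteq> 0"
    using pochhammer_shift_Suc_nonzero[of "Suc m" "l + q"] pochhammer_shift_Suc_nonzero[of n "l + q"]
      z[of "Suc m"] z[of "Suc (Suc (m + l + q))"]
      z[of "Suc (n + l + q)"]
    unfolding a_def b_def s_def t_def r_def by (simp_all add: add_ac)
  have e1: "pochhammer (z + of_nat n + of_nat (Suc m) + 1) (l + 1) = W * (z + ?n + ?m + 2 + ?L)"
    unfolding W_def by (simp add: pochhammer_Suc algebra_simps)
  have e2: "pochhammer (z + of_nat n + of_nat m + 1) (l + 1) = (z + ?n + ?m + 1) * W"
    unfolding W_def using pochhammer_rec[of "z + of_nat n + of_nat m + 1" l] by (simp add: add_ac)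
  have e3: "pochhammer (z + ?n + 1) (l + q + 1) = b * r"
    unfolding b_def r_def by (simp add: pochhammer_Suc algebra_simps)
  have e4: "pochhammer (z + of_nat (Suc m) + 1) (l + q + 1) = a * t"
    unfolding a_def t_def by (simp add: pochhammer_Suc algebra_simps)
  have e5: "pochhammer (z + ?m + 1) (l + q + 1) = s * a"
    unfolding a_def s_def using pochhammer_rec[of "z + of_nat m + 1" "l + q"] by (simp add: add_ac)
  have e6: "pochhammer (z + ?m + 1) (l + Suc q + 1) = s * a * t"
    using e5 unfolding t_def by (simp add: pochhammer_Suc algebra_simps)
  have e7: "pochhammer (z + ?Q) (l + 1) = (z + ?Q) * P"
    unfolding P_def using pochhammer_rec[of "z + ?Q" l] by (simp add: add_ac)
  have e8: "pochhammer (z + of_nat (Suc q)) (l + 1) = P * (z + ?Q + 1 + ?L)"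
    unfolding P_def by (simp add: pochhammer_Suc algebra_simps)
  have e9: "of_nat (Suc q) * of_nat ((l + Suc q) choose Suc q) = (?L + ?Q + 1) * c"
    using Suc_times_binomial[of q "l + q"] unfolding c_def of_nat_mult[symmetric]
    by (simp add: add_ac flip: of_nat_add of_nat_mult of_nat_Suc)
  have e10: "pochhammer (z + ?n + 1) (l + Suc q) = b * r"
    using e3 by simp
  have e11: "ffact ?n (Suc q) = u * (?n - ?Q)"
    unfolding u_def by (rule ffact_Suc)
  show ?thesis
  \<comment> \<open>The exponent \<open>q - 1\<close> in \<open>vwp_cert\<close> is truncated at 0,
    and the relations \<open>v1\<close> and \<open>v2\<close> below hold only for q > 0.\<close>
  proof (cases q)
    case 0
    have L: "vwp_cert z l n m q = 0" by (simp add: vwp_cert_def 0)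
    have R: "vwp_cert z l n m (Suc q) = (?L + 1) * c * (u * ?n) * (P * (z + 1 + ?L)) * W / (b * r * (s * a * t))"
      unfolding vwp_cert_def e9 e10 e6 e8 e11 W_def[symmetric] using 0 by simp
    have T: "vwp_term z l n (Suc m) q = c * u * P * (z + ?L + 1) * s / (b * r * (s * a * t))"
      "vwp_term z l n m q = c * u * P * (z + ?L + 1) * t / (b * r * (s * a * t))"
      unfolding vwp_term_def e3 e4 e5 c_def[symmetric] u_def[symmetric] P_def[symmetric]
      using nz 0 by (simp_all add: field_simps)
    have t0: "t = z + ?m + ?L + 2"
      by (simp add: t_def 0)
    have "c * u * P * (z + ?L + 1) * s * (W * (z + ?n + ?m + 2 + ?L))
        - c * u * P * (z + ?L + 1) * t * ((z + ?n + ?m + 1) * W)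
        = - ((?L + 1) * c * (u * ?n) * (P * (z + 1 + ?L)) * W)"
      unfolding s_def t0 by algebra
    then show ?thesis
      unfolding L R T e1 e2 times_divide_eq_left diff_divide_distrib[symmetric] by simp
  next
    case (Suc k)
    have k: "of_nat k = ?Q - 1" by (simp add: Suc)
    have v1: "ffact (of_nat (Suc m)) q = (?m + 1) * v"
      unfolding v_def Suc using ffact_rec[of ?m k] by (simp add: add_ac)
    have v2: "ffact ?m q = v * (?m - ?Q + 1)"
      unfolding v_def Suc by (simp add: ffact_Suc)
    have v3: "ffact ?m (Suc q - 1) = v * (?m - ?Q + 1)"
      using v2 by simp
    let ?D = "b * r * (s * a * t)"
    have L: "vwp_cert z l n m q = ?Q * c * u * v * ((z + ?Q) * P) * W * r * t / ?D"
      unfolding vwp_cert_def e7 e5 W_def[symmetric] c_def[symmetric] u_def[symmetric] v_def[symmetric]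
        b_def[symmetric] using nz by (simp add: field_simps)
    have R: "vwp_cert z l n m (Suc q) = (?L + ?Q + 1) * c * (u * (?n - ?Q)) * (v * (?m - ?Q + 1))
        * (P * (z + ?Q + 1 + ?L)) * W / ?D"
      unfolding vwp_cert_def e9 e10 e6 e8 e11 W_def[symmetric] v3 by (rule refl)
    have T: "vwp_term z l n (Suc m) q = c * u * ((?m + 1) * v) * P * (z + ?L + 1 + 2 * ?Q) * s / ?D"
      "vwp_term z l n m q = c * u * (v * (?m - ?Q + 1)) * P * (z + ?L + 1 + 2 * ?Q) * t / ?D"
      unfolding vwp_term_def e3 e4 e5 c_def[symmetric] u_def[symmetric] P_def[symmetric] v1 v2
      using nz by (simp_all add: field_simps)
    show ?thesis
      unfolding L R T e1 e2
      unfolding times_divide_eq_left diff_divide_distrib[symmetric]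
      \<comment> \<open>With \<open>?D\<close> as the only denominator, a polynomial identity
        between numerators remains.\<close>
      by (rule arg_cong[of _ _ "\<lambda>X. X / ?D"]) (unfold s_def t_def r_def, algebra)
  qed
qed

lemma vwp_sum:
  "(\<Sum>q\<le>n. vwp_term z l n m q) = 1 / pochhammer (z + of_nat n + of_nat m + 1) (l + 1)"
proof -
  have "(\<Sum>q\<le>n. vwp_term z l n m q) * pochhammer (z + of_nat n + of_nat m + 1) (l + 1) = 1"
  proof (induction m)
    case 0
    have "vwp_term z l n 0 q = 0" if "q \<noteq> 0" for q
      using that ffact_of_nat_eq_0[of 0 q, where ?'a='a] by (simp add: vwp_term_def)
    then have "(\<Sum>q\<le>n. vwp_term z l n 0 q) = (\<Sum>q\<in>{0}. vwp_term z l n 0 q)"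
      by (intro sum.mono_neutral_right) auto
    also have "\<dots> = 1 / pochhammer (z + of_nat n + 1) (l + 1)"
      using pochhammer_shift_Suc_nonzero[of 0 "l + 1"] by (simp add: vwp_term_def pochhammer_Suc divide_simps)
    finally show ?case using pochhammer_shift_Suc_nonzero[of n "l + 1"] by simp
  next
    case (Suc m)
    have "(\<Sum>q\<le>n. vwp_term z l n (Suc m) q) * pochhammer (z + of_nat n + of_nat (Suc m) + 1) (l + 1)
       - (\<Sum>q\<le>n. vwp_term z l n m q) * pochhammer (z + of_nat n + of_nat m + 1) (l + 1)
       = (\<Sum>q\<le>n. vwp_cert z l n m q - vwp_cert z l n m (Suc q))"
      by (simp only: sum_distrib_right sum_subtractf[symmetric] vwp_cert_step)
    also have "\<dots> = vwp_cert z l n m 0 - vwp_cert z l n m (Suc n)"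
      by (rule sum_telescope)
    \<comment> \<open>The lower end vanishes by the factor q, the upper end because the falling
      factorial of n of length n + 1 contains 0.\<close>
    also have "\<dots> = 0"
      using ffact_of_nat_eq_0[of n "Suc n", where ?'a='a] by (simp add: vwp_cert_def)
    finally show ?case using Suc by simp
  qed
  moreover have "pochhammer (z + of_nat n + of_nat m + 1) (l + 1) \<noteq> 0"
    using pochhammer_shift_Suc_nonzero[of "n + m" "l + 1"] by (simp add: add_ac)
  ultimately show ?thesis by (simp add: field_simps)
qed

end

section \<open>The boundary part l = 0\<close>

definition shifted_harm :: "'a::field_char_0 \<Rightarrow> nat \<Rightarrow> 'a" where
  "shifted_harm z n = (\<Sum>k<n. 1 / (z + of_nat k + 1))"

text \<open>For q > 0 this is the derivative at b = 0 of the very-well-poised term with leading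
  parameter z and further parameters b, -n, -m. This is why its sum is made of harmonic sums instead
  of a product.\<close>

definition boundary_term :: "'a::field_char_0 \<Rightarrow> nat \<Rightarrow> nat \<Rightarrow> nat \<Rightarrow> 'a" where
  "boundary_term z n m q = ffact (of_nat n) q * ffact (of_nat m) q * (z + 2 * of_nat q)
     / (of_nat q * (z + of_nat q) * (pochhammer (z + of_nat n + 1) q * pochhammer (z + of_nat m + 1) q))"

text \<open>With q = r + 1, the increment in m rests on (m + 1)(z + m + 1) - (m + 1 - q)(z + m + 1 +
  q) = q(z + q). This cancels the denominator q(z + q) and leaves a term summable by
  \<open>vwp_sum\<close> with z shifted by 1.\<close>

lemma boundary_term_step:
  fixes z :: "'a::field_char_0"
  assumes z: "\<And>n. z + of_nat n \<noteq> 0"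
  shows "boundary_term z (Suc n) (Suc m) (Suc r) - boundary_term z (Suc n) m (Suc r)
    = of_nat (Suc n) / (z + of_nat m + 1) * vwp_term (z + 1) 0 n m r"
proof -
  define X where "X = pochhammer (z + of_nat m + 2) r"
  define Y where "Y = pochhammer (z + of_nat n + 2) (Suc r)"
  define u :: 'a where "u = ffact (of_nat n) r"
  define v :: 'a where "v = ffact (of_nat m) r"
  let ?r = "of_nat r :: 'a" and ?n = "of_nat n :: 'a" and ?m = "of_nat m :: 'a"
  define s where "s = z + ?m + 1"
  define t where "t = z + ?m + ?r + 2"
  define c where "c = z + ?r + 1"
  define d where "d = ?r + 1"
  have nz: "X \<noteq> 0" "Y \<noteq> 0" "s \<noteq> 0" "t \<noteq> 0" "c \<noteq> 0" "d \<noteq> 0"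
    using pochhammer_shift_nonzero[OF z, of "m + 2" r] pochhammer_shift_nonzero[OF z, of "n + 2" "Suc r"]
      z[of "Suc m"] z[of "m + r + 2"] z[of "Suc r"] of_nat_neq_0[of r, where ?'a='a]
    unfolding X_def Y_def s_def t_def c_def d_def by (simp_all add: add_ac)
  have e1: "pochhammer (z + of_nat (Suc n) + 1) (Suc r) = Y"
    unfolding Y_def by (simp add: add_ac)
  have e2: "pochhammer (z + of_nat (Suc m) + 1) (Suc r) = X * t"
    unfolding X_def t_def by (simp add: pochhammer_Suc algebra_simps)
  have e3: "pochhammer (z + ?m + 1) (Suc r) = s * X"
    unfolding X_def s_def using pochhammer_rec[of "z + of_nat m + 1" r] by (simp add: add_ac)
  have e4: "pochhammer (z + 1 + ?m + 1) (0 + r + 1) = X * t" "pochhammer (z + 1 + ?n + 1) (0 + r + 1) = Y"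
    unfolding e2[symmetric] e1[symmetric] by (simp_all add: add_ac)
  have f1: "ffact (of_nat (Suc n)) (Suc r) = (?n + 1) * u"
    unfolding u_def using ffact_rec[of ?n r] by (simp add: add_ac)
  have f2: "ffact (of_nat (Suc m)) (Suc r) = (?m + 1) * v"
    unfolding v_def using ffact_rec[of ?m r] by (simp add: add_ac)
  have f3: "ffact (of_nat m) (Suc r) = v * (?m - ?r)"
    unfolding v_def by (rule ffact_Suc)
  have L: "boundary_term z (Suc n) (Suc m) (Suc r) = (?n + 1) * u * ((?m + 1) * v) * (c + d) * s / (d * c * (Y * (s * X * t)))"
    "boundary_term z (Suc n) m (Suc r) = (?n + 1) * u * (v * (?m - ?r)) * (c + d) * t / (d * c * (Y * (s * X * t)))"
  proof -
    have D: "of_nat (Suc r) = d" "z + d = c" "z + 2 * d = c + d"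
      by (simp_all add: c_def d_def algebra_simps)
    show "boundary_term z (Suc n) (Suc m) (Suc r) = (?n + 1) * u * ((?m + 1) * v) * (c + d) * s / (d * c * (Y * (s * X * t)))"
      "boundary_term z (Suc n) m (Suc r) = (?n + 1) * u * (v * (?m - ?r)) * (c + d) * t / (d * c * (Y * (s * X * t)))"
      unfolding boundary_term_def e1 e2 e3 f1 f2 f3 D using nz by (simp_all add: field_simps)
  qed
  have R: "vwp_term (z + 1) 0 n m r = u * v * (c + d) / (Y * (X * t))"
    unfolding vwp_term_def e4 u_def[symmetric] v_def[symmetric] c_def d_def by (simp add: algebra_simps)
  have "of_nat (Suc n) / (z + ?m + 1) * vwp_term (z + 1) 0 n m r
      = (?n + 1) * u * v * (c + d) * (d * c) / (d * c * (Y * (s * X * t)))"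
    unfolding R using nz s_def[symmetric] by (simp add: field_simps)
  moreover have "(?n + 1) * u * ((?m + 1) * v) * (c + d) * s - (?n + 1) * u * (v * (?m - ?r)) * (c + d) * t
      = (?n + 1) * u * v * (c + d) * (d * c)"
    unfolding s_def t_def c_def d_def by algebra
  ultimately show ?thesis
    unfolding L diff_divide_distrib[symmetric] by simp
qed

lemma boundary_sum:
  fixes z :: "'a::field_char_0"
  assumes z: "\<And>n. z + of_nat n \<noteq> 0"
  shows "(\<Sum>r<n. boundary_term z n m (Suc r)) = shifted_harm z n + shifted_harm z m - shifted_harm z (n + m)"
\<comment> \<open>The increment formula is stated for \<open>Suc n\<close>, so n = 0 is separate;
  for fixed n > 0 the induction runs over m.\<close>
proof (cases n)
  case 0
  then show ?thesis by (simp add: shifted_harm_def)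
next
  case n: (Suc k)
  show ?thesis
  proof (induction m)
    case 0
    have "boundary_term z n 0 (Suc r) = 0" for r
      using ffact_of_nat_eq_0[of 0 "Suc r", where ?'a='a] by (simp add: boundary_term_def)
    then show ?case by (simp add: shifted_harm_def)
  next
    case (Suc m)
    have z1: "\<And>n. z + 1 + of_nat n \<noteq> 0"
      using z[of "Suc _"] by (simp add: add_ac)
    have nz: "z + of_nat m + 1 \<noteq> 0" "z + of_nat n + of_nat m + 1 \<noteq> 0"
      using z[of "Suc m"] z[of "Suc (n + m)"] by (simp_all add: add_ac)
    have "(\<Sum>r<n. boundary_term z n (Suc m) (Suc r)) - (\<Sum>r<n. boundary_term z n m (Suc r))
      = of_nat n / (z + of_nat m + 1) * (\<Sum>r\<le>k. vwp_term (z + 1) 0 k m r)"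
      unfolding n sum_subtractf[symmetric] boundary_term_step[OF z] lessThan_Suc_atMost sum_distrib_left ..
    also have "\<dots> = of_nat n / (z + of_nat m + 1) * (1 / (z + of_nat n + of_nat m + 1))"
      unfolding vwp_sum[OF z1] by (simp add: n add_ac)
    also have "\<dots> = 1 / (z + of_nat m + 1) - 1 / (z + of_nat n + of_nat m + 1)"
      using nz by (simp add: divide_simps)
    finally show ?case using Suc
      by (simp add: shifted_harm_def algebra_simps)
  qed
qed

section \<open>Alternating sums over l\<close>

text \<open>A case of Chu-Vandermonde: the sum is 2F1(-M, 1; w + 1; 1) / w. Splitting off l = 0
  leaves the same sum for M - 1 and w + 1.\<close>

lemma alternating_ffact_sum:
  fixes w :: "'a::field_char_0"
  assumes "\<And>n. w + of_nat n \<noteq> 0"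
  shows "(\<Sum>l\<le>M. (-1) ^ l * ffact (of_nat M) l / pochhammer w (Suc l)) = 1 / (w + of_nat M)"
  using assms
proof (induction M arbitrary: w)
  case (Suc M)
  have nz: "w \<noteq> 0" "w + 1 + of_nat M \<noteq> 0" and w1: "\<And>n. w + 1 + of_nat n \<noteq> 0"
    using Suc.prems[of 0] Suc.prems[of "Suc _"] by (simp_all add: add_ac)
  have "(-1) ^ Suc l * ffact (of_nat (Suc M)) (Suc l) / pochhammer w (Suc (Suc l))
      = - of_nat (Suc M) / w * ((-1) ^ l * ffact (of_nat M) l / pochhammer (w + 1) (Suc l))" for l
  proof -
    have "ffact (of_nat (Suc M)) (Suc l) = (of_nat (Suc M) * ffact (of_nat M) l :: 'a)"
      using ffact_rec[of "of_nat M :: 'a" l] by (simp add: add_ac)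
    then show ?thesis
      unfolding pochhammer_rec[of w "Suc l"] by (simp del: of_nat_Suc)
  qed
  note step = this
  have "(\<Sum>l\<le>Suc M. (-1) ^ l * ffact (of_nat (Suc M)) l / pochhammer w (Suc l))
      = 1 / w - of_nat (Suc M) / w * (\<Sum>l\<le>M. (-1) ^ l * ffact (of_nat M) l / pochhammer (w + 1) (Suc l))"
    unfolding sum.atMost_Suc_shift step sum_distrib_left[symmetric] by (simp del: of_nat_Suc)
  also have "\<dots> = 1 / w - of_nat (Suc M) / w * (1 / (w + 1 + of_nat M))"
    by (simp only: Suc.IH[OF w1])
  also have "\<dots> = 1 / (w + of_nat (Suc M))"
    using nz by (simp add: divide_simps add_ac)
  finally show ?case .
qed simp

text \<open>Passing from M to M + 1 changes \<open>ffact (of_nat M) (Suc l) / of_nat (Suc l)\<close>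
  by \<open>ffact (of_nat M) l\<close>, so the sum grows by the value 1 / (w + M) of the preceding
  lemma.\<close>

lemma harmonic_ffact_sum:
  fixes w :: "'a::field_char_0"
  assumes w: "\<And>n. w + of_nat n \<noteq> 0"
  shows "(\<Sum>l<M. (-1) ^ l * ffact (of_nat M) (Suc l) / of_nat (Suc l) / pochhammer w (Suc l))
    = (\<Sum>k<M. 1 / (w + of_nat k))"
proof (induction M)
  case (Suc M)
  have "ffact (of_nat (Suc M)) (Suc l) - ffact (of_nat M) (Suc l) = (of_nat (Suc l) * ffact (of_nat M) l :: 'a)" for l
    using ffact_rec[of "of_nat M :: 'a" l] by (simp add: ffact_Suc algebra_simps)
  then have *: "ffact (of_nat (Suc M)) (Suc l) = (ffact (of_nat M) (Suc l) + of_nat (Suc l) * ffact (of_nat M) l :: 'a)" for l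
    by (metis diff_add_cancel add.commute)
  have "(-1) ^ l * ffact (of_nat (Suc M)) (Suc l) / of_nat (Suc l) / pochhammer w (Suc l)
     = (-1) ^ l * ffact (of_nat M) (Suc l) / of_nat (Suc l) / pochhammer w (Suc l)
       + (-1) ^ l * ffact (of_nat M) l / pochhammer w (Suc l)" for l
    unfolding * ring_distribs add_divide_distrib using of_nat_neq_0[of l, where ?'a='a] by (simp del: of_nat_Suc)
  then have "(\<Sum>l<Suc M. (-1) ^ l * ffact (of_nat (Suc M)) (Suc l) / of_nat (Suc l) / pochhammer w (Suc l))
     = (\<Sum>l<Suc M. (-1) ^ l * ffact (of_nat M) (Suc l) / of_nat (Suc l) / pochhammer w (Suc l))
       + (\<Sum>l\<le>M. (-1) ^ l * ffact (of_nat M) l / pochhammer w (Suc l))"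
    by (simp only: sum.distrib lessThan_Suc_atMost)
  also have "(\<Sum>l<Suc M. (-1) ^ l * ffact (of_nat M) (Suc l) / of_nat (Suc l) / pochhammer w (Suc l))
     = (\<Sum>l<M. (-1) ^ l * ffact (of_nat M) (Suc l) / of_nat (Suc l) / pochhammer w (Suc l))"
    using ffact_of_nat_eq_0[of M "Suc M", where ?'a='a] by simp
  finally show ?case
    by (simp only: Suc alternating_ffact_sum[OF w] sum.lessThan_Suc)
qed simp

section \<open>The double sum as a combination of harmonic sums\<close>

text \<open>The summand divided by the differentiated function. It vanishes for \<open>l + q = 0\<close> by the
  convention \<open>c / 0 = 0\<close>, which matches the exclusion of \<open>p = N\<close>.\<close>

definition log_deriv_term :: "'a::field_char_0 \<Rightarrow> nat \<Rightarrow> nat \<Rightarrow> nat \<Rightarrow> nat \<Rightarrow> nat \<Rightarrow> 'a" where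
  "log_deriv_term z i j M q l =
     (-1) ^ (l + 1) * ffact (of_nat (l + q)) q * ffact (of_nat i) q * ffact (of_nat j) q * ffact (of_nat M) l
       * pochhammer (z + 1) (l + q - 1) * (z + of_nat l + 2 * of_nat q)
     / (of_nat (l + q) * fact q * pochhammer (z + 1) q
       * (pochhammer (z + of_nat i + 1) (l + q) * pochhammer (z + of_nat j + 1) (l + q)))"

text \<open>The falling factorial of q of length q cancels q!, and the quotient of the Pochhammer
  symbols at z + 1 is 1 / (z + q). The arguments appear as \<open>j i\<close> because
  \<open>boundary_sum\<close> sums up to its first parameter, and q runs up to j.\<close>

lemma log_deriv_term_0:
  fixes z :: "'a::field_char_0"
  assumes z: "\<And>n. z + of_nat n \<noteq> 0"
  shows "log_deriv_term z i j M (Suc r) 0 = - boundary_term z j i (Suc r)"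
proof -
  have "pochhammer (z + 1) r \<noteq> 0"
    using pochhammer_shift_nonzero[OF z, of 1 r] by simp
  moreover have "ffact (of_nat (Suc r)) (Suc r) = (fact (Suc r) :: 'a)"
    using ffact_eq_fact_binomial[of 0 "Suc r", where ?'a='a] by simp
  moreover have "pochhammer (z + 1) (Suc r) = pochhammer (z + 1) r * (z + of_nat (Suc r))"
    by (simp add: pochhammer_Suc algebra_simps)
  ultimately show ?thesis
    unfolding log_deriv_term_def boundary_term_def by (simp del: fact_Suc of_nat_Suc add: mult_ac)
qed

text \<open>Separates the dependence on M from the sum over q. The absorption rule (l + 1) C(l + q +
  1, q) = (l + q + 1) C(l + q, q) removes the denominator l + q + 1.\<close>

lemma log_deriv_term_Suc:
  fixes z :: "'a::field_char_0"
  assumes z: "\<And>n. z + of_nat n \<noteq> 0"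
  shows "log_deriv_term z i j M q (Suc l) = (-1) ^ l * ffact (of_nat M) (Suc l) / of_nat (Suc l) * vwp_term z l j i q"
proof -
  define A where "A = pochhammer (z + 1) q"
  define B :: 'a where "B = of_nat ((l + q) choose q)"
  define k :: 'a where "k = of_nat (Suc (l + q))"
  have nz: "A \<noteq> 0" "k \<noteq> 0" "of_nat (Suc l) \<noteq> (0 :: 'a)"
    using pochhammer_shift_nonzero[OF z, of 1 q, unfolded of_nat_1] of_nat_neq_0[of "l + q", where ?'a='a]
      of_nat_neq_0[of l, where ?'a='a]
    unfolding A_def k_def by (simp_all del: of_nat_Suc)
  have "of_nat (Suc l) * of_nat (Suc (l + q) choose q) = k * B"
  proof -
    have "Suc l * (Suc (l + q) choose q) = Suc (l + q) * ((l + q) choose q)"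
      using Suc_times_binomial_eq[of "l + q" l] binomial_symmetric[of l "l + q"]
        binomial_symmetric[of q "Suc (l + q)"] by (simp add: mult.commute del: binomial_Suc_Suc)
    then show ?thesis
      unfolding k_def B_def of_nat_mult[symmetric] by simp
  qed
  then have "ffact (of_nat (Suc l + q)) q = fact q * (k * B) / of_nat (Suc l)"
    unfolding ffact_eq_fact_binomial using nz by (simp add: field_simps del: of_nat_Suc)
  moreover have k: "of_nat (Suc l + q) = k" by (simp add: k_def)
  ultimately have b: "ffact k q = fact q * (k * B) / of_nat (Suc l)" by simp
  have p: "pochhammer (z + 1) (Suc l + q - 1) = A * pochhammer (z + of_nat q + 1) l"
    using pochhammer_product'[of "z + 1" q l] by (simp add: A_def add_ac)
  have e: "Suc l + q = l + q + 1" "z + of_nat (Suc l) + 2 * of_nat q = z + of_nat l + 1 + 2 * of_nat q"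
    by simp_all
  show ?thesis
    unfolding log_deriv_term_def p k b
    unfolding vwp_term_def A_def[symmetric] B_def[symmetric] e
    using nz by (simp del: of_nat_Suc add: mult_ac)
qed

lemma log_deriv_sum:
  fixes z :: "'a::field_char_0"
  assumes z: "\<And>n. z + of_nat n \<noteq> 0"
  shows "(\<Sum>q\<le>j. \<Sum>l\<le>M. log_deriv_term z i j M q l)
    = shifted_harm z (i + j + M) - shifted_harm z i - shifted_harm z j"
proof -
  \<comment> \<open>The base of the Pochhammer symbol in the value of \<open>vwp_sum\<close> for j
    and i.\<close>
  define w where "w = z + of_nat j + of_nat i + 1"
  have w: "w + of_nat n \<noteq> 0" for n
    using z[of "Suc (j + i + n)"] by (simp add: w_def add_ac)
  have "(\<Sum>q\<le>j. \<Sum>l\<le>M. log_deriv_term z i j M q l)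
      = (\<Sum>q\<le>j. log_deriv_term z i j M q 0) + (\<Sum>q\<le>j. \<Sum>l<M. log_deriv_term z i j M q (Suc l))"
    unfolding lessThan_Suc_atMost[symmetric] sum.lessThan_Suc_shift sum.distrib ..
  \<comment> \<open>The term q = 0 drops out, being a division by 0.\<close>
  also have "(\<Sum>q\<le>j. log_deriv_term z i j M q 0) = - (\<Sum>r<j. boundary_term z j i (Suc r))"
    unfolding lessThan_Suc_atMost[symmetric] sum.lessThan_Suc_shift log_deriv_term_0[OF z]
    by (simp add: log_deriv_term_def sum_negf)
  also have "(\<Sum>q\<le>j. \<Sum>l<M. log_deriv_term z i j M q (Suc l))
      = (\<Sum>l<M. (-1) ^ l * ffact (of_nat M) (Suc l) / of_nat (Suc l) * (\<Sum>q\<le>j. vwp_term z l j i q))"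
    unfolding log_deriv_term_Suc[OF z] sum_distrib_left by (rule sum.swap)
  also have "\<dots> = (\<Sum>k<M. 1 / (w + of_nat k))"
    unfolding vwp_sum[OF z] w_def[symmetric] harmonic_ffact_sum[OF w, symmetric] by simp
  also have "(\<Sum>k<M. 1 / (w + of_nat k)) = shifted_harm z (i + j + M) - shifted_harm z (i + j)"
  proof (induction M)
    case (Suc M)
    then show ?case by (simp add: shifted_harm_def w_def add_ac)
  qed simp
  finally show ?thesis
    unfolding boundary_sum[OF z] by (simp add: add_ac)
qed

section \<open>Differentiation of rational functions and of falling factorials\<close>

lemma ratfun_deriv_mult:
  fixes f g :: "'a::field poly fract"
  shows "ratfun_deriv (f * g) = ratfun_deriv f * g + f * ratfun_deriv g"
proof -
  obtain a b where f: "f = Fract a b" "b \<noteq> 0" by (cases f)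
  obtain c d where g: "g = Fract c d" "d \<noteq> 0" by (cases g)
  show ?thesis
    unfolding f(1) g(1) using f(2) g(2)
    by (simp add: ratfun_deriv_Fract eq_fract pderiv_mult) algebra
qed

lemma ratfun_deriv_divide:
  fixes f g :: "'a::field poly fract"
  assumes "g \<noteq> 0"
  shows "ratfun_deriv (f / g) = (ratfun_deriv f - f / g * ratfun_deriv g) / g"
proof -
  have "ratfun_deriv f = ratfun_deriv (f / g * g)" using assms by simp
  also have "\<dots> = ratfun_deriv (f / g) * g + f / g * ratfun_deriv g"
    by (rule ratfun_deriv_mult)
  finally show ?thesis using assms by (simp add: eq_divide_eq)
qed

lemma ratfun_X_shift:
  "(ratfun_X :: 'a::field poly fract) - of_nat m + of_nat n = Fract [:of_nat n - of_nat m, 1:] 1"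
  by (simp add: ratfun_X_def of_nat_fract of_nat_poly)

text \<open>A polynomial of degree 1 is nonzero. This supplies the hypothesis on \<open>z\<close> in
  the summation lemmas for z = X - m.\<close>

lemma ratfun_X_shift_nonzero: "(ratfun_X :: 'a::field poly fract) - of_nat m + of_nat n \<noteq> 0"
  unfolding ratfun_X_shift by (simp add: Zero_fract_def eq_fract)

lemma ratfun_deriv_ffact_X:
  "ratfun_deriv (ffact ratfun_X r) = ffact ratfun_X r * (\<Sum>k<r. 1 / ((ratfun_X :: 'a::field poly fract) - of_nat k))"
proof (induction r)
  case 0
  show ?case by (simp add: One_fract_def ratfun_deriv_Fract) (simp add: Zero_fract_def eq_fract)
next
  case (Suc r)
  have "ratfun_deriv ((ratfun_X :: 'a poly fract) - of_nat r) = 1"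
    using ratfun_X_shift[of r 0, where ?'a='a]
    by (simp add: ratfun_deriv_Fract pderiv_pCons) (simp add: One_fract_def one_pCons eq_fract)
  moreover have "(ratfun_X :: 'a poly fract) - of_nat r \<noteq> 0"
    using ratfun_X_shift_nonzero[of r 0, where ?'a='a] by simp
  ultimately show ?case
    by (simp add: ffact_Suc ratfun_deriv_mult Suc distrib_left distrib_right mult_ac)
qed

lemma ffact_add: "ffact a (r + k) = ffact a r * ffact (a - of_nat r) k"
  by (induction k) (simp_all add: ffact_Suc algebra_simps)

lemma ffact_eq_pochhammer: "ffact b k = pochhammer (b - of_nat k + 1) k"
proof (induction k arbitrary: b)
  case (Suc k)
  have "ffact b (Suc k) = b * ffact (b - 1) k"
    using ffact_rec[of "b - 1" k] by simp
  also have "\<dots> = b * pochhammer (b - of_nat k) k"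
    unfolding Suc by (simp add: algebra_simps)
  finally show ?case
    by (simp add: pochhammer_Suc mult.commute)
qed simp

text \<open>With z = x - N, the denominators are z + i + 1, ..., z + N in reverse order; the
  induction runs downwards from i = N.\<close>

lemma sum_inverse_eq_shifted_harm:
  fixes x :: "'a::field_char_0"
  assumes "i \<le> N"
  shows "(\<Sum>k<N - i. 1 / (x - of_nat k)) = shifted_harm (x - of_nat N) N - shifted_harm (x - of_nat N) i"
  using assms
proof (induction i rule: inc_induct)
  case base
  show ?case by simp
next
  case (step i)
  have *: "N - i = Suc (N - Suc i)" using step by simp
  have "x - of_nat (N - Suc i) = x - of_nat N + of_nat i + 1"
    using step by (simp add: of_nat_diff)
  with step.IH show ?case
    unfolding * by (simp add: shifted_harm_def del: of_nat_diff)
qed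

section \<open>Logarithmic derivative and substitution p = N - q - l\<close>

theorem theoremE:
  fixes i j N :: nat
    and x :: "'a::field_char_0 poly fract"
  assumes "i + j \<le> N"
    and "x = ratfun_X"
  shows "ratfun_deriv (ffact x (N - i) * ffact x (N - j) / ffact x N) =
    (\<Sum>q\<in>{0..j}. \<Sum>p | i + j - q \<le> p \<and> p \<le> N - q \<and> p < N.
       ((-1) ^ (N + p + q + 1) * ffact (of_nat (N - p)) q * ffact (of_nat i) q * ffact (of_nat j) q
          * ffact (of_nat (N - i - j)) (N - p - q) * ffact x (p - i) * ffact x (p - j)
          * (x - of_nat p + of_nat q))
       / (of_nat (N - p) * of_nat (fact q) * ffact x (p + 1) * ffact (x - of_nat N + of_nat q) q))"
    (is "_ = (\<Sum>q\<in>_. \<Sum>p\<in>?P q. ?F q p)")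
proof -
  define z where "z = x - of_nat N"
  define M where "M = N - i - j"
  define f where "f = ffact x (N - i) * ffact x (N - j) / ffact x N"
  have z: "z + of_nat n \<noteq> 0" for n
    unfolding z_def assms(2) by (rule ratfun_X_shift_nonzero)
  have M: "i + j + M = N" using assms(1) by (simp add: M_def)
  have ffact_nz: "ffact x r \<noteq> 0" for r
    using ratfun_X_shift_nonzero[of _ 0, where ?'a='a] unfolding ffact_def assms(2) by simp

  \<comment> \<open>For p = N - k this splits the falling factorial of length N - a into the one of
    length p - a, as in the summand, and a Pochhammer symbol in z.\<close>
  have factor: "ffact x (N - a) = ffact x (N - k - a) * pochhammer (z + of_nat a + 1) k" if "k + a \<le> N" for a k
  proof -
    have "N - a = (N - k - a) + k" using that by simp
    then have "ffact x (N - a) = ffact x (N - k - a) * ffact (x - of_nat (N - k - a)) k"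
      by (metis ffact_add)
    moreover have "x - of_nat (N - k - a) - of_nat k + 1 = z + of_nat a + 1"
    proof -
      have "N = (N - k - a) + k + a" using that by simp
      then have "(of_nat N :: 'a poly fract) = of_nat (N - k - a) + of_nat k + of_nat a"
        by (metis of_nat_add)
      then show ?thesis by (simp add: z_def)
    qed
    ultimately show ?thesis by (simp add: ffact_eq_pochhammer[of _ k])
  qed

  have summand: "?F q (N - q - l) = f * log_deriv_term z i j M q l"
    if "q \<le> i" "q \<le> j" "l \<le> M" "0 < l + q" for q l
  proof -
    define k where "k = l + q"
    have k: "N - q - l = N - k" "N - (N - k) = k" "k - q = l" "k + i \<le> N" "k + j \<le> N" "0 < k" "k \<le> N"
      using that M by (auto simp: k_def)
    \<comment> \<open>Shows that the exponent of -1 has the parity of l + 1.\<close>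
    have "N + (N - k) + q + 1 = l + 1 + 2 * (N - l)"
      using k by (simp add: k_def)
    then have sgn: "(-1 :: 'a poly fract) ^ (N + (N - k) + q + 1) = (-1) ^ (l + 1)"
      by (simp only: power_add power_mult) simp
    have lin: "x - of_nat (N - k) + of_nat q = z + of_nat l + 2 * of_nat q"
      using k by (simp add: z_def of_nat_diff) (simp add: k_def)
    \<comment> \<open>The summand contains the falling factorial of length p + 1, so only k - 1
      factors are split off; this needs k > 0, that is p < N.\<close>
    have den: "ffact x N = ffact x (N - k + 1) * pochhammer (z + 1) (k - 1)"
      using factor[of "k - 1" 0] k by (simp add: Suc_diff_le)
    have den': "ffact (x - of_nat N + of_nat q) q = pochhammer (z + 1) q"
      by (simp add: ffact_eq_pochhammer z_def)
    have nz: "pochhammer (z + 1) r \<noteq> 0" "pochhammer (z + of_nat s + 1) r \<noteq> 0" for r s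
      using pochhammer_shift_Suc_nonzero[OF z, of 0] pochhammer_shift_Suc_nonzero[OF z] by simp_all
    show ?thesis
      unfolding k(1-3) sgn lin den' f_def den factor[OF k(4)] factor[OF k(5)] log_deriv_term_def k_def[symmetric]
        M_def[symmetric] of_nat_fact
      using nz ffact_nz by (simp add: mult_ac)
  qed

  have inner: "(\<Sum>p\<in>?P q. ?F q p) = (\<Sum>l\<le>M. f * log_deriv_term z i j M q l)" if "q \<le> j" for q
  \<comment> \<open>For q > i the subtraction \<open>p - j\<close> may be truncated, but the factor
    \<open>ffact (of_nat i) q\<close> makes both sides 0.\<close>
  proof (cases "q \<le> i")
    case False
    then have "ffact (of_nat i) q = (0 :: 'a poly fract)"
      by (simp add: ffact_of_nat_eq_0)
    then show ?thesis by (simp add: log_deriv_term_def)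
  next
    case True
    have "(\<Sum>p\<in>?P q. ?F q p) = (\<Sum>l | l \<le> M \<and> 0 < l + q. f * log_deriv_term z i j M q l)"
    \<comment> \<open>The substitution is its own inverse: i + j - q <= p becomes l <= M, and p < N
      becomes 0 < l + q.\<close>
    proof (rule sum.reindex_bij_witness[where i = "\<lambda>l. N - q - l" and j = "\<lambda>p. N - q - p"])
      fix p assume p: "p \<in> ?P q"
      then have "f * log_deriv_term z i j M q (N - q - p) = ?F q (N - q - (N - q - p))"
        using that True M by (intro summand[symmetric]) auto
      moreover have "N - q - (N - q - p) = p" using p that M by auto
      ultimately show "f * log_deriv_term z i j M q (N - q - p) = ?F q p" by (simp only:)
    qed (use that True M in auto)
    \<comment> \<open>The only index that can be added is l = q = 0, where division by 0 gives
      0.\<close>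
    also have "\<dots> = (\<Sum>l\<le>M. f * log_deriv_term z i j M q l)"
      by (rule sum.mono_neutral_left) (auto simp: log_deriv_term_def)
    finally show ?thesis .
  qed

  have harm: "(\<Sum>k<N - i. 1 / (x - of_nat k)) = shifted_harm z N - shifted_harm z i"
    "(\<Sum>k<N - j. 1 / (x - of_nat k)) = shifted_harm z N - shifted_harm z j"
    "(\<Sum>k<N. 1 / (x - of_nat k)) = shifted_harm z N"
    using sum_inverse_eq_shifted_harm[of i N x] sum_inverse_eq_shifted_harm[of j N x]
      sum_inverse_eq_shifted_harm[of 0 N x] M
    by (auto simp: z_def shifted_harm_def[of _ 0])
  \<comment> \<open>The product and quotient rules give f times its logarithmic derivative.\<close>
  have "ratfun_deriv f
      = f * (\<Sum>k<N - i. 1 / (x - of_nat k)) + f * (\<Sum>k<N - j. 1 / (x - of_nat k)) - f * (\<Sum>k<N. 1 / (x - of_nat k))"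
    unfolding f_def ratfun_deriv_divide[OF ffact_nz] ratfun_deriv_mult
    unfolding assms(2) ratfun_deriv_ffact_X using ffact_nz[unfolded assms(2), of N]
    by (simp add: field_simps)
  also have "\<dots> = f * (shifted_harm z (i + j + M) - shifted_harm z i - shifted_harm z j)"
    unfolding harm M by (simp add: algebra_simps)
  also have "\<dots> = (\<Sum>q\<le>j. \<Sum>l\<le>M. f * log_deriv_term z i j M q l)"
    unfolding log_deriv_sum[OF z, symmetric] sum_distrib_left ..
  also have "\<dots> = (\<Sum>q\<in>{0..j}. \<Sum>p\<in>?P q. ?F q p)"
    by (rule sum.cong) (auto simp only: atMost_atLeast0 atLeastAtMost_iff inner)
  finally show ?thesis unfolding f_def .
qed

end
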